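(* Let $X$ be a Banach space, $(\Theta,\mu)$ a complete measure space and $\mathcal X=L_1(\Theta,X)$ (Bochner space). Let $\{(T_m,D(T_m))\}_{m\in\Theta}$ be a family of operators in $X$ such that for almost every $m\in\Theta$ the operator $(T_m,D(T_m))$ generates a $C_0$-semigroup $(G_m(t))_{t\ge 0}$ on $X$ with $\|G_m(t)\|_{L(X)}\le M_me^{\omega_m t}$, $t\ge0$, for some $M_m\ge 1$ and $\omega_m\in\mathbb R$. If for any $u\in\mathcal X$ and any fixed $t\ge0$ the function $m\mapsto G_m(t)u(m)$ is Bochner-measurable, and there exists a function $[0,\infty)\ni t\mapsto M(t)\in[0,\infty)$ such that $\sup_{m\in\Theta}M_me^{\omega_mt}\le M(t)$ for any $t\ge 0$, then the family $(\mathbf G(t))_{t\ge0}$ given by $$[\mathbf G(t)u](m)=G_m(t)u(m),\qquad u\in\mathcal X,\ m\in\Theta,$$ is a $C_0$-semigroup on $\mathcal X$ generated by the operator $\mathbf T$ defined by $[\mathbf Tu](m)=T_mu(m)$, $m\in\Theta$, on $D(\mathbf T)=\{u\in\mathcal X:\ u(m)\in D(T_m)\text{ for }m\in\Theta,\ \mathbf Tu\in\mathcal X\}$.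
   Context: $L(X)$ is the space of bounded linear operators on $X$. Pointwise properties "for $m\in\Theta$" (including the supremum over $m$) are understood for almost every $m$, i.e. those $m$ for which $G_m$ is defined. *)

theory Defs
  imports "HOL-Analysis.Analysis"
begin

(* Normed spaces as structures with a carrier set, so that one definition of a C_0-semigroup
   covers both a Banach space given as a type and L_1(Theta, X), whose carrier depends on the
   measure and therefore is not a type.  The scalar field 'k is the real or the complex field. *)

record ('k, 'v) nspace =
  carr :: "'v set"
  vadd :: "'v \<Rightarrow> 'v \<Rightarrow> 'v"
  vscale :: "'k \<Rightarrow> 'v \<Rightarrow> 'v"
  vnorm :: "'v \<Rightarrow> real"

definition vdiff :: "('k::real_normed_field, 'v) nspace \<Rightarrow> 'v \<Rightarrow> 'v \<Rightarrow> 'v" where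
  "vdiff E x y = vadd E x (vscale E (- 1) y)"

definition vtendsto ::
    "('k::real_normed_field, 'v) nspace \<Rightarrow> ('t \<Rightarrow> 'v) \<Rightarrow> 'v \<Rightarrow> 't filter \<Rightarrow> bool" where
  "vtendsto E f l F \<longleftrightarrow> ((\<lambda>t. vnorm E (vdiff E (f t) l)) \<longlongrightarrow> 0) F"

definition bounded_operator ::
    "('k::real_normed_field, 'v) nspace \<Rightarrow> ('v \<Rightarrow> 'v) \<Rightarrow> bool" where
  "bounded_operator E A \<longleftrightarrow>
     (\<forall>x\<in>carr E. A x \<in> carr E) \<and>
     (\<forall>x\<in>carr E. \<forall>y\<in>carr E. A (vadd E x y) = vadd E (A x) (A y)) \<and>
     (\<forall>c. \<forall>x\<in>carr E. A (vscale E c x) = vscale E c (A x)) \<and>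
     (\<exists>K. \<forall>x\<in>carr E. vnorm E (A x) \<le> K * vnorm E x)"

definition C0_semigroup ::
    "('k::real_normed_field, 'v) nspace \<Rightarrow> (real \<Rightarrow> 'v \<Rightarrow> 'v) \<Rightarrow> bool" where
  "C0_semigroup E G \<longleftrightarrow>
     (\<forall>t\<ge>0. bounded_operator E (G t)) \<and>
     (\<forall>x\<in>carr E. G 0 x = x) \<and>
     (\<forall>s\<ge>0. \<forall>t\<ge>0. \<forall>x\<in>carr E. G (s + t) x = G s (G t x)) \<and>
     (\<forall>x\<in>carr E. vtendsto E (\<lambda>t. G t x) x (at_right 0))"

definition diff_quotient ::
    "('k::real_normed_field, 'v) nspace \<Rightarrow> (real \<Rightarrow> 'v \<Rightarrow> 'v) \<Rightarrow> 'v \<Rightarrow> real \<Rightarrow> 'v" where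
  "diff_quotient E G x h = vscale E (of_real (1 / h)) (vdiff E (G h x) x)"

(* An unbounded operator (A, D(A)) is a function together with its domain; values of the
   function outside the domain are irrelevant. *)

definition generates ::
    "('k::real_normed_field, 'v) nspace \<Rightarrow> 'v set \<Rightarrow> ('v \<Rightarrow> 'v) \<Rightarrow> (real \<Rightarrow> 'v \<Rightarrow> 'v) \<Rightarrow> bool" where
  "generates E D A G \<longleftrightarrow>
     C0_semigroup E G \<and>
     D = {x \<in> carr E. \<exists>y\<in>carr E. vtendsto E (diff_quotient E G x) y (at_right 0)} \<and>
     (\<forall>x\<in>D. A x \<in> carr E \<and> vtendsto E (diff_quotient E G x) (A x) (at_right 0))"

(* A real normed space 'a that is also a normed space over 'k by means of sc.  For 'k = real this
   forces sc = scaleR; for 'k = complex it describes complex normed spaces, for which the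
   libraries have no type class. *)

definition normed_scaling :: "('k::real_normed_field \<Rightarrow> 'a::real_normed_vector \<Rightarrow> 'a) \<Rightarrow> bool" where
  "normed_scaling sc \<longleftrightarrow>
     vector_space sc \<and>
     (\<forall>r x. sc (of_real r) x = r *\<^sub>R x) \<and>
     (\<forall>c x. norm (sc c x) = norm c * norm x)"

definition type_space ::
    "('k::real_normed_field \<Rightarrow> 'a::real_normed_vector \<Rightarrow> 'a) \<Rightarrow> ('k, 'a) nspace" where
  "type_space sc = \<lparr>carr = UNIV, vadd = (+), vscale = sc, vnorm = norm\<rparr>"

(* The library's Bochner integral requires a second countable (i.e. separable) target space.
   For an arbitrary Banach space measurability is strong measurability. *)

definition bochner_measurable :: "'m measure \<Rightarrow> ('m \<Rightarrow> 'a::real_normed_vector) \<Rightarrow> bool" where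
  "bochner_measurable M f \<longleftrightarrow>
     (\<exists>s. (\<forall>i::nat. simple_function M (s i)) \<and> (AE m in M. (\<lambda>i. s i m) \<longlonglongrightarrow> f m))"

definition bochner_integrable :: "'m measure \<Rightarrow> ('m \<Rightarrow> 'a::real_normed_vector) \<Rightarrow> bool" where
  "bochner_integrable M f \<longleftrightarrow> bochner_measurable M f \<and> integrable M (\<lambda>m. norm (f m))"

(* The elements of L_1(Theta, X) are classes of functions modulo equality almost everywhere.
   The class of a function that is not Bochner integrable is empty, hence not an element. *)

definition L1_class :: "'m measure \<Rightarrow> ('m \<Rightarrow> 'a::real_normed_vector) \<Rightarrow> ('m \<Rightarrow> 'a) set" where
  "L1_class M f = {g. bochner_integrable M g \<and> (AE m in M. g m = f m)}"

definition L1_pointwise ::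
    "'m measure \<Rightarrow> ('m \<Rightarrow> 'a \<Rightarrow> 'a) \<Rightarrow> ('m \<Rightarrow> 'a::real_normed_vector) set \<Rightarrow> ('m \<Rightarrow> 'a) set" where
  "L1_pointwise M F U = (\<Union>u\<in>U. L1_class M (\<lambda>m. F m (u m)))"

definition L1_space ::
    "('k::real_normed_field \<Rightarrow> 'a \<Rightarrow> 'a) \<Rightarrow> 'm measure
       \<Rightarrow> ('k, ('m \<Rightarrow> 'a::real_normed_vector) set) nspace" where
  "L1_space sc M =
     \<lparr>carr = {L1_class M u |u. bochner_integrable M u},
      vadd = (\<lambda>U V. \<Union>u\<in>U. \<Union>v\<in>V. L1_class M (\<lambda>m. u m + v m)),
      vscale = (\<lambda>c. L1_pointwise M (\<lambda>_. sc c)),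
      vnorm = (\<lambda>U. the_elem ((\<lambda>u. \<integral>m. norm (u m) \<partial>M) ` U))\<rparr>"

definition L1_domain ::
    "'m measure \<Rightarrow> ('m \<Rightarrow> 'a set) \<Rightarrow> ('m \<Rightarrow> 'a \<Rightarrow> 'a)
       \<Rightarrow> ('m \<Rightarrow> 'a::real_normed_vector) set set" where
  "L1_domain M D T =
     {L1_class M u |u. bochner_integrable M u \<and> (AE m in M. u m \<in> D m) \<and>
        bochner_integrable M (\<lambda>m. T m (u m))}"

end

theory Submission
  imports Defs
begin

text \<open>The bounds at \<open>t = 0\<close> and \<open>t = 1\<close> give \<open>C m \<le> B 0\<close> and \<open>exp (\<omega> m) \<le> B 1\<close>, so the
  semigroups are uniformly bounded on \<open>[0, 1]\<close> although \<open>B\<close> itself is arbitrary; dominated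
  convergence then gives strong continuity of the lifted semigroup. Convergence of its difference
  quotients in \<open>L\<^sub>1\<close> yields pointwise convergence almost everywhere only along a sequence
  tending to \<open>0\<close>. This is enough: if the difference quotients at \<open>x\<close> tend to \<open>y\<close> along one
  sequence, then \<open>G t x - x\<close> is the integral of \<open>G s y\<close> over \<open>[0, t]\<close>. This identity also
  bounds all difference quotients by a multiple of the norm of \<open>y\<close>, which provides the dominating
  function for the converse inclusion of domains.\<close>

section \<open>Semigroups on a Banach space\<close>

text \<open>Strong continuity at 0 and the generator concern small times only, so the bound is asked
  on \<open>[0, 1]\<close> alone. The constant \<open>K\<close> is a parameter because almost all
  members of the family will share one and the same \<open>K\<close>.\<close>

locale C0_semigroup_bounded =
  fixes G :: "real \<Rightarrow> 'a::banach \<Rightarrow> 'a" and K :: real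
  assumes lin: "0 \<le> t \<Longrightarrow> bounded_linear (G t)"
    and zero: "G 0 x = x"
    and add: "0 \<le> s \<Longrightarrow> 0 \<le> t \<Longrightarrow> G (s + t) x = G s (G t x)"
    and tendsto_zero: "((\<lambda>t. G t x) \<longlongrightarrow> x) (at_right 0)"
    and bound_nonneg: "0 \<le> K"
    and bound: "0 \<le> t \<Longrightarrow> t \<le> 1 \<Longrightarrow> norm (G t x) \<le> K * norm x"
begin

text \<open>For s \<le> t, the increment factors as
  \<open>G t x - G s x = G s (G (t - s) x - x)\<close>. The bound on \<open>G s\<close> therefore
  reduces continuity at every point, from either side, to right continuity at 0.\<close>

lemma continuous_on_orbit: "continuous_on {0..1} (\<lambda>t. G t x)"
proof -
  have step: "norm (G t x - G s x) \<le> K * norm (G (t - s) x - x)"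
    if "0 \<le> s" "s \<le> t" "t \<le> 1" for s t
  proof -
    have "G t x = G s (G (t - s) x)"
      using add[of s "t - s" x] that by simp
    then have "G t x - G s x = G s (G (t - s) x - x)"
      using linear_diff[OF bounded_linear.linear[OF lin]] that by simp
    then show ?thesis
      using bound[of s] that by simp
  qed
  have "\<exists>d>0. \<forall>t\<in>{0..1}. \<bar>t - s\<bar> < d \<longrightarrow> norm (G t x - G s x) < e"
    if s: "s \<in> {0..1}" and e: "0 < e" for s e
  proof -
    \<comment> \<open>Dividing by \<open>K + 1\<close> instead of \<open>K\<close> covers the case
      \<open>K = 0\<close>.\<close>
    have "0 < e / (K + 1)"
      using e bound_nonneg by simp
    then have "\<forall>\<^sub>F h in at_right 0. dist (G h x) x < e / (K + 1)"
      using tendsto_zero by (rule tendstoD[rotated])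
    then obtain d where "0 < d" and d: "\<And>h. 0 < h \<Longrightarrow> h < d \<Longrightarrow> dist (G h x) x < e / (K + 1)"
      unfolding eventually_at_right_field by blast
    have near: "K * norm (G h x - x) < e" if "0 \<le> h" "h < d" for h
    proof (cases "h = 0")
      case True
      then show ?thesis using e by (simp add: zero)
    next
      case False
      have "K * norm (G h x - x) \<le> (K + 1) * norm (G h x - x)"
        by (simp add: algebra_simps)
      also have "\<dots> < (K + 1) * (e / (K + 1))"
        using d[of h] that False bound_nonneg
        by (intro mult_strict_left_mono) (auto simp: dist_norm)
      also have "\<dots> = e"
        using bound_nonneg by simp
      finally show ?thesis .
    qed
    have "norm (G t x - G s x) < e" if t: "t \<in> {0..1}" "\<bar>t - s\<bar> < d" for t
    proof (cases "s \<le> t")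
      case True
      then show ?thesis
        using step[of s t] near[of "t - s"] s t by auto
    next
      case False
      then show ?thesis
        using step[of t s] near[of "s - t"] s t by (auto simp: norm_minus_commute)
    qed
    then show ?thesis
      using \<open>0 < d\<close> by blast
  qed
  then show ?thesis
    by (auto simp: continuous_on_iff dist_norm)
qed

text \<open>This is the fundamental theorem of calculus for the continuous orbit, stated as a right
  derivative at \<open>u\<close>.\<close>

lemma average_tendsto:
  assumes u: "0 \<le> u" "u < 1"
  shows "((\<lambda>h. (1 / h) *\<^sub>R (integral {0..u + h} (\<lambda>s. G s x) - integral {0..u} (\<lambda>s. G s x)))
    \<longlongrightarrow> G u x) (at_right 0)"
proof -
  define F where "F v = integral {0..v} (\<lambda>s. G s x)" for v
  have "(F has_vector_derivative G u x) (at u within {0..1})"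
    unfolding F_def using integral_has_vector_derivative[OF continuous_on_orbit, of u] u by simp
  \<comment> \<open>Since \<open>u < 1\<close>, the interval \<open>{u..1}\<close> is nondegenerate,
    and a derivative within it at \<open>u\<close> is a right derivative.\<close>
  then have "(F has_vector_derivative G u x) (at u within {u..1})"
    by (rule has_vector_derivative_within_subset) (use u in auto)
  then have "(F has_vector_derivative G u x) (at_right u)"
    using u by (simp add: at_within_Icc_at_right)
  then have "((\<lambda>v. (1 / \<bar>v - u\<bar>) *\<^sub>R (F v - (F u + (v - u) *\<^sub>R G u x))) \<longlongrightarrow> 0) (at_right u)"
    unfolding has_vector_derivative_def has_derivative_within by simp
  then have "((\<lambda>h. (1 / \<bar>h\<bar>) *\<^sub>R (F (u + h) - (F u + h *\<^sub>R G u x))) \<longlongrightarrow> 0) (at_right 0)"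
    unfolding filterlim_at_right_to_0[of _ _ u] by (simp add: add.commute)
  moreover have "\<forall>\<^sub>F h in at_right 0. (1 / \<bar>h\<bar>) *\<^sub>R (F (u + h) - (F u + h *\<^sub>R G u x))
      = (1 / h) *\<^sub>R (F (u + h) - F u) - G u x"
    unfolding eventually_at_right_field
    by (intro exI[of _ 1]) (auto simp: algebra_simps)
  ultimately have "((\<lambda>h. (1 / h) *\<^sub>R (F (u + h) - F u) - G u x) \<longlongrightarrow> 0) (at_right 0)"
    by (rule Lim_transform_eventually)
  then show ?thesis
    unfolding F_def by (rule LIM_zero_cancel)
qed

text \<open>As \<open>h\<close> runs through the sequence \<open>X\<close>, the integral of \<open>G s ((G h x - x) / h)\<close> over
  \<open>{0..t}\<close> tends to the right-hand side by boundedness of \<open>G\<close>, and telescopes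
  to a difference of two averages of the orbit of \<open>x\<close>.\<close>

lemma orbit_eq_integral:
  assumes X: "X \<longlonglongrightarrow> 0" "\<And>n. 0 < X n"
    and y: "(\<lambda>n. (1 / X n) *\<^sub>R (G (X n) x - x)) \<longlonglongrightarrow> y"
    and t: "0 \<le> t" "t < 1"
  shows "G t x - x = integral {0..t} (\<lambda>s. G s y)"
proof -
  define F where "F u = integral {0..u} (\<lambda>s. G s x)" for u
  define q where "q n = (1 / X n) *\<^sub>R (G (X n) x - x)" for n
  have cont: "continuous_on {a..b} (\<lambda>s. G s z)" if "0 \<le> a" "b \<le> 1" for a b z
    using continuous_on_orbit by (rule continuous_on_subset) (use that in auto)
  have int: "(\<lambda>s. G s z) integrable_on {a..b}" if "0 \<le> a" "b \<le> 1" for a b z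
    using cont[OF that] by (rule integrable_continuous_real)
  have left: "(\<lambda>n. integral {0..t} (\<lambda>s. G s (q n))) \<longlonglongrightarrow> integral {0..t} (\<lambda>s. G s y)"
  proof (rule LIM_zero_cancel, rule Lim_null_comparison)
    show "(\<lambda>n. K * norm (q n - y) * t) \<longlonglongrightarrow> 0"
      using tendsto_mult_left_zero[OF tendsto_mult_right_zero[OF tendsto_norm_zero[OF LIM_zero[OF y]]]]
      by (simp add: q_def)
    have "norm (integral {0..t} (\<lambda>s. G s (q n)) - integral {0..t} (\<lambda>s. G s y))
        \<le> K * norm (q n - y) * t" for n
    proof -
      have "integral {0..t} (\<lambda>s. G s (q n)) - integral {0..t} (\<lambda>s. G s y)
          = integral {0..t} (\<lambda>s. G s (q n) - G s y)"
        using int[of 0 t] t by (simp add: integral_diff)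
      also have "\<dots> = integral {0..t} (\<lambda>s. G s (q n - y))"
        by (rule integral_cong) (simp add: linear_diff[OF bounded_linear.linear[OF lin]])
      also have "norm \<dots> \<le> K * norm (q n - y) * (t - 0)"
        using t by (intro integral_bound cont bound) auto
      finally show ?thesis by simp
    qed
    then show "\<forall>\<^sub>F n in sequentially. norm (integral {0..t} (\<lambda>s. G s (q n))
        - integral {0..t} (\<lambda>s. G s y)) \<le> K * norm (q n - y) * t"
      by simp
  qed
  have quotient: "(\<lambda>n. (1 / X n) *\<^sub>R (F (u + X n) - F u)) \<longlonglongrightarrow> G u x" if u: "0 \<le> u" "u < 1" for u
    unfolding F_def using average_tendsto[OF u, of x]
    by (rule filterlim_compose) (use X in \<open>auto intro!: tendsto_imp_filterlim_at_right\<close>)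
  \<comment> \<open>The integral over \<open>{X n..t + X n}\<close> minus the one over
    \<open>{0..t}\<close> leaves only the two end pieces. The vanishing term \<open>F 0\<close> is
    written out so that both pieces are averages covered by \<open>quotient\<close>, at
    \<open>t\<close> and at 0. The condition on \<open>X n\<close> keeps the shifted orbit inside
    \<open>[0, 1]\<close>, where its continuity is known.\<close>
  have telescope: "integral {0..t} (\<lambda>s. G s (q n))
      = (1 / X n) *\<^sub>R (F (t + X n) - F t) - (1 / X n) *\<^sub>R (F (0 + X n) - F 0)"
    if h: "t + X n \<le> 1" for n
  proof -
    let ?h = "X n"
    have "0 < ?h" using X(2) .
    have "integral {0..t} (\<lambda>s. G s (q n))
        = integral {0..t} (\<lambda>s. (1 / ?h) *\<^sub>R (G (s + ?h) x - G s x))"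
    proof (rule integral_cong)
      fix s assume "s \<in> {0..t}"
      then have s: "0 \<le> s" by simp
      show "G s (q n) = (1 / ?h) *\<^sub>R (G (s + ?h) x - G s x)"
        unfolding q_def using s \<open>0 < ?h\<close>
        by (simp add: add linear_diff[OF bounded_linear.linear[OF lin]]
            linear_cmul[OF bounded_linear.linear[OF lin]])
    qed
    also have "\<dots> = (1 / ?h) *\<^sub>R integral {0..t} (\<lambda>s. G (s + ?h) x - G s x)"
      by simp
    also have "integral {0..t} (\<lambda>s. G (s + ?h) x - G s x)
        = integral {0..t} (\<lambda>s. G (s + ?h) x) - F t"
      unfolding F_def
    proof (rule integral_diff)
      show "(\<lambda>s. G (s + ?h) x) integrable_on {0..t}"
        using integrable_shift_real_ivl[OF int[of ?h "t + ?h"], of ?h] h \<open>0 < ?h\<close> by simp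
    qed (use int t in auto)
    also have "integral {0..t} (\<lambda>s. G (s + ?h) x) = integral {?h..t + ?h} (\<lambda>s. G s x)"
      using integral_shift_real_ivl[of "?h" ?h "t + ?h" "\<lambda>s. G s x"] by simp
    also have "\<dots> = F (t + ?h) - F ?h"
      unfolding F_def using Henstock_Kurzweil_Integration.integral_combine[of 0 ?h "t + ?h" "\<lambda>s. G s x"]
        int[of 0 "t + ?h"] t h \<open>0 < ?h\<close>
      by (simp add: algebra_simps)
    finally show ?thesis
      by (simp add: F_def algebra_simps)
  qed
  \<comment> \<open>Here \<open>t < 1\<close> is used: the telescoping identity holds for all large
    \<open>n\<close>.\<close>
  have "\<forall>\<^sub>F n in sequentially. X n < 1 - t"
    using X(1) t by (intro order_tendstoD) auto
  then have "\<forall>\<^sub>F n in sequentially. (1 / X n) *\<^sub>R (F (t + X n) - F t)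
      - (1 / X n) *\<^sub>R (F (0 + X n) - F 0) = integral {0..t} (\<lambda>s. G s (q n))"
    by eventually_elim (simp add: telescope)
  moreover have "(\<lambda>n. (1 / X n) *\<^sub>R (F (t + X n) - F t)
      - (1 / X n) *\<^sub>R (F (0 + X n) - F 0)) \<longlonglongrightarrow> G t x - G 0 x"
    by (intro tendsto_diff quotient) (use t in auto)
  ultimately have "(\<lambda>n. integral {0..t} (\<lambda>s. G s (q n))) \<longlonglongrightarrow> G t x - G 0 x"
    by (rule Lim_transform_eventually[rotated])
  then show ?thesis
    using LIMSEQ_unique left zero by metis
qed

text \<open>The numerator is an integral of \<open>G s y\<close> over an interval of length
  \<open>t\<close>, and this length cancels the denominator. The resulting bound does not depend on
  \<open>t\<close>, as a dominating function requires.\<close>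

lemma norm_diff_quotient_le:
  assumes X: "X \<longlonglongrightarrow> 0" "\<And>n. 0 < X n"
    and y: "(\<lambda>n. (1 / X n) *\<^sub>R (G (X n) x - x)) \<longlonglongrightarrow> y"
    and t: "0 < t" "t < 1"
  shows "norm ((1 / t) *\<^sub>R (G t x - x)) \<le> K * norm y"
proof -
  have "norm (G t x - x) \<le> K * norm y * (t - 0)"
    unfolding orbit_eq_integral[OF X y less_imp_le[OF t(1)] t(2)] using t
    by (intro integral_bound continuous_on_subset[OF continuous_on_orbit] bound) auto
  then show ?thesis
    using t by (simp add: pos_divide_le_eq mult_ac)
qed

text \<open>Convergence along one sequence already makes every difference quotient with step in
  \<open>(0, 1)\<close> an average of the orbit of \<open>y\<close>. These averages tend to
  \<open>G 0 y = y\<close> as the full one-sided limit.\<close>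

lemma tendsto_diff_quotient:
  assumes X: "X \<longlonglongrightarrow> 0" "\<And>n. 0 < X n"
    and y: "(\<lambda>n. (1 / X n) *\<^sub>R (G (X n) x - x)) \<longlonglongrightarrow> y"
  shows "((\<lambda>t. (1 / t) *\<^sub>R (G t x - x)) \<longlongrightarrow> y) (at_right 0)"
proof -
  have "((\<lambda>t. (1 / t) *\<^sub>R integral {0..t} (\<lambda>s. G s y)) \<longlongrightarrow> y) (at_right 0)"
    using average_tendsto[of 0 y] by (simp add: zero)
  moreover have "\<forall>\<^sub>F t in at_right 0. (1 / t) *\<^sub>R integral {0..t} (\<lambda>s. G s y) = (1 / t) *\<^sub>R (G t x - x)"
    unfolding eventually_at_right_field using orbit_eq_integral[OF X y] by (intro exI[of _ 1]) auto
  ultimately show ?thesis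
    by (rule Lim_transform_eventually)
qed

end

section \<open>Bochner integrable functions\<close>

lemma bochner_measurable_add:
  assumes "bochner_measurable M f" "bochner_measurable M g"
  shows "bochner_measurable M (\<lambda>m. f m + g m)"
proof -
  obtain s r where s: "\<And>i. simple_function M (s i)" "AE m in M. (\<lambda>i::nat. s i m) \<longlonglongrightarrow> f m"
    and r: "\<And>i. simple_function M (r i)" "AE m in M. (\<lambda>i::nat. r i m) \<longlonglongrightarrow> g m"
    using assms unfolding bochner_measurable_def by blast
  show ?thesis
    unfolding bochner_measurable_def
  proof (intro exI[of _ "\<lambda>i m. s i m + r i m"] conjI allI)
    show "simple_function M (\<lambda>m. s i m + r i m)" for i
      using s(1) r(1) by (rule simple_function_compose2)
    show "AE m in M. (\<lambda>i. s i m + r i m) \<longlonglongrightarrow> f m + g m"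
      using s(2) r(2) by eventually_elim (rule tendsto_add)
  qed
qed

lemma bochner_measurable_bounded_linear:
  assumes h: "bounded_linear h" and f: "bochner_measurable M f"
  shows "bochner_measurable M (\<lambda>m. h (f m))"
proof -
  obtain s where s: "\<And>i. simple_function M (s i)" "AE m in M. (\<lambda>i::nat. s i m) \<longlonglongrightarrow> f m"
    using f unfolding bochner_measurable_def by blast
  show ?thesis
    unfolding bochner_measurable_def
  proof (intro exI[of _ "\<lambda>i m. h (s i m)"] conjI allI)
    show "simple_function M (\<lambda>m. h (s i m))" for i
      using s(1) by (rule simple_function_compose1)
    show "AE m in M. (\<lambda>i. h (s i m)) \<longlonglongrightarrow> h (f m)"
      using s(2) by eventually_elim (rule bounded_linear.tendsto[OF h])
  qed
qed

lemma bochner_measurable_cong: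
  assumes "bochner_measurable M f" and "AE m in M. f m = g m"
  shows "bochner_measurable M g"
proof -
  obtain s where s: "\<And>i. simple_function M (s i)" "AE m in M. (\<lambda>i::nat. s i m) \<longlonglongrightarrow> f m"
    using assms(1) unfolding bochner_measurable_def by blast
  have "AE m in M. (\<lambda>i. s i m) \<longlonglongrightarrow> g m"
    using s(2) assms(2) by eventually_elim simp
  with s(1) show ?thesis
    unfolding bochner_measurable_def by blast
qed

context complete_measure
begin

text \<open>Preimages under \<open>f\<close> and \<open>g\<close> differ only inside a null set, and
  completeness makes such a set measurable.\<close>

lemma borel_measurable_cong:
  assumes f: "f \<in> borel_measurable M" and eq: "AE m in M. f m = g m"
  shows "g \<in> borel_measurable M"
proof (rule measurableI)
  fix A :: "'b set" assume A: "A \<in> sets borel"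
  show "g -` A \<inter> space M \<in> sets M"
  proof (rule in_sets_AE)
    show "AE m in M. m \<in> f -` A \<inter> space M \<longleftrightarrow> m \<in> g -` A \<inter> space M"
      using eq by eventually_elim simp
    show "f -` A \<inter> space M \<in> sets M"
      using f A by (rule measurable_sets)
  qed simp
qed simp

text \<open>The simple functions converge only almost everywhere. The function \<open>lim\<close> is
  total and measurable, and completeness transfers measurability from it to the norm of
  \<open>f\<close>.\<close>

lemma borel_measurable_norm_bochner:
  assumes "bochner_measurable M f"
  shows "(\<lambda>m. norm (f m)) \<in> borel_measurable M"
proof -
  obtain s where s: "\<And>i. simple_function M (s i)" "AE m in M. (\<lambda>i::nat. s i m) \<longlonglongrightarrow> f m"
    using assms unfolding bochner_measurable_def by blast
  have "(\<lambda>m. norm (s i m)) \<in> borel_measurable M" for i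
    using simple_function_compose1[OF s(1), of norm] by (rule borel_measurable_simple_function)
  then have "(\<lambda>m. lim (\<lambda>i. norm (s i m))) \<in> borel_measurable M"
    by (rule borel_measurable_lim_metric)
  moreover have "AE m in M. lim (\<lambda>i. norm (s i m)) = norm (f m)"
    using s(2) by eventually_elim (intro limI tendsto_norm)
  ultimately show ?thesis
    by (rule borel_measurable_cong)
qed

lemma bochner_integrable_bound:
  assumes "bochner_measurable M f" and "integrable M w" and "AE m in M. norm (f m) \<le> w m"
  shows "bochner_integrable M f"
  unfolding bochner_integrable_def
proof
  have "AE m in M. norm (norm (f m)) \<le> norm (w m)"
    using assms(3) by eventually_elim simp
  then show "integrable M (\<lambda>m. norm (f m))"
    using assms(1,2) by (intro Bochner_Integration.integrable_bound[OF assms(2)] borel_measurable_norm_bochner)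
qed (fact assms(1))

lemma bochner_integrable_cong:
  assumes "bochner_integrable M f" and "AE m in M. f m = g m"
  shows "bochner_integrable M g"
proof (rule bochner_integrable_bound)
  show "bochner_measurable M g"
    using assms bochner_measurable_cong by (auto simp: bochner_integrable_def)
  show "integrable M (\<lambda>m. norm (f m))"
    using assms by (simp add: bochner_integrable_def)
  show "AE m in M. norm (g m) \<le> norm (f m)"
    using assms(2) by eventually_elim simp
qed

lemma bochner_integrable_add:
  assumes "bochner_integrable M f" and "bochner_integrable M g"
  shows "bochner_integrable M (\<lambda>m. f m + g m)"
proof (rule bochner_integrable_bound)
  show "bochner_measurable M (\<lambda>m. f m + g m)"
    using assms by (simp add: bochner_integrable_def bochner_measurable_add)
  show "integrable M (\<lambda>m. norm (f m) + norm (g m))"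
    using assms by (simp add: bochner_integrable_def)
qed (simp add: norm_triangle_ineq)

lemma bochner_integrable_bounded_linear:
  assumes h: "bounded_linear h" and f: "bochner_integrable M f"
  shows "bochner_integrable M (\<lambda>m. h (f m))"
proof (rule bochner_integrable_bound)
  show "bochner_measurable M (\<lambda>m. h (f m))"
    using f by (simp add: bochner_integrable_def bochner_measurable_bounded_linear[OF h])
  show "integrable M (\<lambda>m. onorm h * norm (f m))"
    using f by (simp add: bochner_integrable_def)
qed (simp add: onorm[OF h])

lemma bochner_integrable_diff:
  assumes "bochner_integrable M f" and "bochner_integrable M g"
  shows "bochner_integrable M (\<lambda>m. f m - g m)"
  using bochner_integrable_add[OF assms(1)
      bochner_integrable_bounded_linear[OF bounded_linear_minus[OF bounded_linear_ident] assms(2)]]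
  by simp

end

text \<open>The one-sided limit is tested along sequences in \<open>(0, 1)\<close>, and each of them
  is handled by dominated convergence.\<close>

lemma integral_tendsto_zero_at_right:
  fixes f :: "real \<Rightarrow> 'm \<Rightarrow> real"
  assumes meas: "\<And>t. 0 < t \<Longrightarrow> t < 1 \<Longrightarrow> f t \<in> borel_measurable M"
    and w: "integrable M w"
    and bound: "\<And>t. 0 < t \<Longrightarrow> t < 1 \<Longrightarrow> AE m in M. norm (f t m) \<le> w m"
    and lim: "AE m in M. ((\<lambda>t. f t m) \<longlongrightarrow> 0) (at_right 0)"
  shows "((\<lambda>t. \<integral>m. f t m \<partial>M) \<longlongrightarrow> 0) (at_right 0)"
proof (rule tendsto_at_right_sequentially[of 0 1])
  fix S :: "nat \<Rightarrow> real"
  assume S: "\<And>n. 0 < S n" "\<And>n. S n < 1" "S \<longlonglongrightarrow> 0"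
  have "(\<lambda>n. \<integral>m. f (S n) m \<partial>M) \<longlonglongrightarrow> (\<integral>m. 0 \<partial>M)"
  proof (rule integral_dominated_convergence[OF _ _ w])
    have "filterlim S (at_right 0) sequentially"
      using S by (intro tendsto_imp_filterlim_at_right) auto
    then show "AE m in M. (\<lambda>n. f (S n) m) \<longlonglongrightarrow> 0"
      using lim by (auto elim!: eventually_mono filterlim_compose)
  qed (use S meas bound in auto)
  then show "(\<lambda>n. \<integral>m. f (S n) m \<partial>M) \<longlonglongrightarrow> 0"
    by simp
qed simp

section \<open>The space of classes of integrable functions\<close>

lemma L1_class_cong:
  assumes "AE m in M. u m = v m"
  shows "L1_class M u = L1_class M v"
proof -
  have "(AE m in M. g m = u m) \<longleftrightarrow> (AE m in M. g m = v m)" for g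
  proof
    assume "AE m in M. g m = u m"
    with assms show "AE m in M. g m = v m" by eventually_elim simp
  next
    assume "AE m in M. g m = v m"
    with assms show "AE m in M. g m = u m" by eventually_elim simp
  qed
  then show ?thesis
    by (simp add: L1_class_def)
qed

lemma L1_class_self: "bochner_integrable M u \<Longrightarrow> u \<in> L1_class M u"
  by (simp add: L1_class_def)

lemma L1_classD: "v \<in> L1_class M u \<Longrightarrow> AE m in M. v m = u m"
  by (simp add: L1_class_def)

text \<open>All representatives yield the same class, so the union in \<open>L1_pointwise\<close>
  has equal members. Integrability of \<open>u\<close> ensures that the union is not empty. From
  here on, operators on classes are computed on one representative.\<close>

lemma L1_pointwise_class:
  assumes "bochner_integrable M u"
  shows "L1_pointwise M F (L1_class M u) = L1_class M (\<lambda>m. F m (u m))"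
proof -
  have "L1_class M (\<lambda>m. F m (v m)) = L1_class M (\<lambda>m. F m (u m))" if "v \<in> L1_class M u" for v
    by (rule L1_class_cong) (use L1_classD[OF that] in eventually_elim, simp)
  then show ?thesis
    unfolding L1_pointwise_def using L1_class_self[OF assms] by blast
qed

lemma carr_L1_space: "carr (L1_space sc M) = {L1_class M u |u. bochner_integrable M u}"
  by (simp add: L1_space_def)

lemma vadd_L1_class:
  assumes "bochner_integrable M u" "bochner_integrable M v"
  shows "vadd (L1_space sc M) (L1_class M u) (L1_class M v) = L1_class M (\<lambda>m. u m + v m)"
proof -
  have "L1_class M (\<lambda>m. u' m + v' m) = L1_class M (\<lambda>m. u m + v m)"
    if "u' \<in> L1_class M u" "v' \<in> L1_class M v" for u' v'
    by (rule L1_class_cong) (use L1_classD[OF that(1)] L1_classD[OF that(2)] in eventually_elim, simp)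
  then have "(\<Union>u'\<in>L1_class M u. \<Union>v'\<in>L1_class M v. L1_class M (\<lambda>m. u' m + v' m))
      = L1_class M (\<lambda>m. u m + v m)"
    using L1_class_self[OF assms(1)] L1_class_self[OF assms(2)] by blast
  then show ?thesis
    by (simp add: L1_space_def)
qed

lemma vscale_L1_class:
  assumes "bochner_integrable M u"
  shows "vscale (L1_space sc M) c (L1_class M u) = L1_class M (\<lambda>m. sc c (u m))"
  using L1_pointwise_class[OF assms] by (simp add: L1_space_def)

text \<open>The norm integral is constant on the class, so its image is a singleton and
  \<open>the_elem\<close> returns the intended value.\<close>

lemma (in complete_measure) vnorm_L1_class:
  assumes "bochner_integrable M u"
  shows "vnorm (L1_space sc M) (L1_class M u) = (\<integral>m. norm (u m) \<partial>M)"
proof -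
  have "(\<integral>m. norm (v m) \<partial>M) = (\<integral>m. norm (u m) \<partial>M)" if v: "v \<in> L1_class M u" for v
  proof (rule integral_cong_AE)
    show "AE m in M. norm (v m) = norm (u m)"
      using L1_classD[OF v] by eventually_elim simp
  qed (use v assms in \<open>auto simp: L1_class_def bochner_integrable_def\<close>)
  then have "(\<lambda>v. \<integral>m. norm (v m) \<partial>M) ` L1_class M u = {\<integral>m. norm (u m) \<partial>M}"
    using L1_class_self[OF assms] by blast
  then show ?thesis
    by (simp add: L1_space_def)
qed

section \<open>Translation of \<open>type_space sc\<close> into the usual notions for normed
  spaces\<close>

lemma normed_scaling_of_real: "normed_scaling sc \<Longrightarrow> sc (of_real r) x = r *\<^sub>R x"
  by (simp add: normed_scaling_def)

lemma normed_scaling_minus_one: "normed_scaling sc \<Longrightarrow> sc (- 1) x = - x"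
  using normed_scaling_of_real[of sc "- 1" x] by simp

lemma bounded_linear_normed_scaling:
  assumes "normed_scaling sc"
  shows "bounded_linear (sc c)"
proof (rule bounded_linear_intro)
  interpret vector_space sc
    using assms by (simp add: normed_scaling_def)
  show "sc c (x + y) = sc c x + sc c y" for x y
    by (rule scale_right_distrib)
  show "sc c (r *\<^sub>R x) = r *\<^sub>R sc c x" for r x
    \<comment> \<open>Real scalars act through \<open>of_real\<close>, and multiplication in the
      scalar field commutes, so \<open>sc c\<close> is real linear.\<close>
    by (simp flip: normed_scaling_of_real[OF assms] add: mult.commute)
  show "norm (sc c x) \<le> norm x * norm c" for x
    using assms by (simp add: normed_scaling_def)
qed

lemma carr_type_space: "carr (type_space sc) = UNIV"
  by (simp add: type_space_def)

lemma vdiff_type_space: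
  "normed_scaling sc \<Longrightarrow> vdiff (type_space sc) x y = x - y"
  by (simp add: vdiff_def type_space_def normed_scaling_minus_one)

lemma vtendsto_type_space:
  assumes "normed_scaling sc"
  shows "vtendsto (type_space sc) f l F \<longleftrightarrow> (f \<longlongrightarrow> l) F"
  unfolding vtendsto_def vdiff_type_space[OF assms]
  by (simp add: type_space_def tendsto_norm_zero_iff LIM_zero_iff)

lemma diff_quotient_type_space:
  assumes "normed_scaling sc"
  shows "diff_quotient (type_space sc) G x h = (1 / h) *\<^sub>R (G h x - x)"
  unfolding diff_quotient_def vdiff_type_space[OF assms]
  by (simp add: type_space_def normed_scaling_of_real[OF assms] del: of_real_divide)

lemma bounded_operator_type_space:
  assumes "normed_scaling sc" and "bounded_operator (type_space sc) A"
  shows "bounded_linear A"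
proof -
  obtain K where K: "norm (A x) \<le> K * norm x" for x
    using assms(2) by (auto simp: bounded_operator_def type_space_def)
  have "A (r *\<^sub>R x) = r *\<^sub>R A x" for r x
    using assms(2) by (simp add: bounded_operator_def type_space_def
        flip: normed_scaling_of_real[OF assms(1)])
  then show ?thesis
    using assms(2) K by (intro bounded_linear_intro[where K = K])
      (auto simp: bounded_operator_def type_space_def mult.commute)
qed

section \<open>Differences and convergence in \<open>L1_space\<close>\<close>

context complete_measure
begin

lemma vdiff_L1_class:
  assumes "normed_scaling sc" "bochner_integrable M u" "bochner_integrable M v"
  shows "vdiff (L1_space sc M) (L1_class M u) (L1_class M v) = L1_class M (\<lambda>m. u m - v m)"
  using assms bochner_integrable_bounded_linear[OF bounded_linear_normed_scaling[OF assms(1)], of v "- 1"]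
  by (simp add: vdiff_def vscale_L1_class vadd_L1_class normed_scaling_minus_one)

text \<open>Reduces convergence of classes to a limit of real integrals. Representatives are
  required only eventually, because the lifted operators are controlled only at nonnegative times,
  which suffices for \<open>at_right 0\<close>.\<close>

lemma vtendsto_L1_class:
  assumes sc: "normed_scaling sc" and l: "bochner_integrable M l"
    and f: "\<forall>\<^sub>F t in F. bochner_integrable M (f t) \<and> U t = L1_class M (f t)"
  shows "vtendsto (L1_space sc M) U (L1_class M l) F \<longleftrightarrow>
    ((\<lambda>t. \<integral>m. norm (f t m - l m) \<partial>M) \<longlongrightarrow> 0) F"
  unfolding vtendsto_def
proof (rule tendsto_cong)
  show "\<forall>\<^sub>F t in F. vnorm (L1_space sc M) (vdiff (L1_space sc M) (U t) (L1_class M l))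
      = (\<integral>m. norm (f t m - l m) \<partial>M)"
    using f by eventually_elim
      (simp add: vdiff_L1_class[OF sc] l vnorm_L1_class bochner_integrable_diff)
qed

end

lemma C0_semigroup_bounded_type_space:
  assumes sc: "normed_scaling sc" and G: "C0_semigroup (type_space sc) G"
    and K: "0 \<le> K" "\<And>t x. 0 \<le> t \<Longrightarrow> t \<le> 1 \<Longrightarrow> norm (G t x) \<le> K * norm x"
  shows "C0_semigroup_bounded G K"
proof (rule C0_semigroup_bounded.intro)
  show "bounded_linear (G t)" if "0 \<le> t" for t
    using G that bounded_operator_type_space[OF sc] by (simp add: C0_semigroup_def)
  show "((\<lambda>t. G t x) \<longlongrightarrow> x) (at_right 0)" for x
    using G unfolding C0_semigroup_def vtendsto_type_space[OF sc] by (simp add: type_space_def)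
qed (use G K in \<open>auto simp: C0_semigroup_def type_space_def\<close>)

section \<open>Families of semigroups acting pointwise\<close>

text \<open>The two bounds have different tasks. \<open>bound_at\<close> makes each lifted operator
  bounded, with a null set that may depend on \<open>t\<close>. \<open>uniform_bound\<close> has one
  null set for all times in \<open>[0, 1]\<close> and supplies the dominating functions for the
  limits at 0.\<close>

locale semigroup_family = complete_measure M for M :: "'m measure" +
  fixes sc :: "'k::real_normed_field \<Rightarrow> 'a::banach \<Rightarrow> 'a"
    and G :: "'m \<Rightarrow> real \<Rightarrow> 'a \<Rightarrow> 'a" and K :: real and B :: "real \<Rightarrow> real"
  assumes sc: "normed_scaling sc"
    and semigroup: "AE m in M. C0_semigroup (type_space sc) (G m)"
    and measurable_orbit:
      "bochner_integrable M u \<Longrightarrow> 0 \<le> t \<Longrightarrow> bochner_measurable M (\<lambda>m. G m t (u m))"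
    and uniform_bound_nonneg: "0 \<le> K"
    and uniform_bound: "AE m in M. \<forall>t x. 0 \<le> t \<longrightarrow> t \<le> 1 \<longrightarrow> norm (G m t x) \<le> K * norm x"
    and bound_at: "0 \<le> t \<Longrightarrow> AE m in M. \<forall>x. norm (G m t x) \<le> B t * norm x"
begin

abbreviation lifted :: "real \<Rightarrow> ('m \<Rightarrow> 'a) set \<Rightarrow> ('m \<Rightarrow> 'a) set" where
  "lifted t \<equiv> L1_pointwise M (\<lambda>m. G m t)"

lemma AE_bounded: "AE m in M. C0_semigroup_bounded (G m) K"
  using semigroup uniform_bound
  by eventually_elim (rule C0_semigroup_bounded_type_space[OF sc _ uniform_bound_nonneg], auto)

lemma integrable_orbit:
  assumes u: "bochner_integrable M u" and t: "0 \<le> t"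
  shows "bochner_integrable M (\<lambda>m. G m t (u m))"
proof (rule bochner_integrable_bound)
  show "bochner_measurable M (\<lambda>m. G m t (u m))"
    using u t by (rule measurable_orbit)
  show "integrable M (\<lambda>m. B t * norm (u m))"
    using u by (simp add: bochner_integrable_def)
  show "AE m in M. norm (G m t (u m)) \<le> B t * norm (u m)"
    using bound_at[OF t] by eventually_elim simp
qed

lemma bounded_operator_lifted:
  assumes t: "0 \<le> t"
  shows "bounded_operator (L1_space sc M) (lifted t)"
proof -
  have lin: "AE m in M. bounded_linear (G m t)"
    using AE_bounded by eventually_elim (rule C0_semigroup_bounded.lin[OF _ t])
  have carr: "lifted t (L1_class M u) \<in> carr (L1_space sc M)" if "bochner_integrable M u" for u
    using that integrable_orbit[OF that t] by (auto simp: L1_pointwise_class carr_L1_space)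
  have add: "lifted t (vadd (L1_space sc M) (L1_class M u) (L1_class M v)) =
      vadd (L1_space sc M) (lifted t (L1_class M u)) (lifted t (L1_class M v))"
    if u: "bochner_integrable M u" and v: "bochner_integrable M v" for u v
  proof -
    have "L1_class M (\<lambda>m. G m t (u m + v m)) = L1_class M (\<lambda>m. G m t (u m) + G m t (v m))"
      by (rule L1_class_cong)
        (use lin in eventually_elim, simp add: linear_add bounded_linear.linear)
    then show ?thesis
      using u v t by (simp add: L1_pointwise_class vadd_L1_class bochner_integrable_add integrable_orbit)
  qed
  have scale: "lifted t (vscale (L1_space sc M) c (L1_class M u)) =
      vscale (L1_space sc M) c (lifted t (L1_class M u))"
    if u: "bochner_integrable M u" for c u
  proof -
    \<comment> \<open>The fact \<open>lin\<close> gives homogeneity for real scalars only. For the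
      scalars of the field it is taken from \<open>bounded_operator\<close>.\<close>
    have "AE m in M. G m t (sc c (u m)) = sc c (G m t (u m))"
      using semigroup by eventually_elim
        (use t in \<open>auto simp: C0_semigroup_def bounded_operator_def type_space_def\<close>)
    from L1_class_cong[OF this] show ?thesis
      using u t by (simp add: L1_pointwise_class vscale_L1_class integrable_orbit
          bochner_integrable_bounded_linear[OF bounded_linear_normed_scaling[OF sc]])
  qed
  have bound: "vnorm (L1_space sc M) (lifted t (L1_class M u)) \<le> B t * vnorm (L1_space sc M) (L1_class M u)"
    if u: "bochner_integrable M u" for u
  proof -
    have "(\<integral>m. norm (G m t (u m)) \<partial>M) \<le> (\<integral>m. B t * norm (u m) \<partial>M)"
    proof (rule integral_mono_AE)
      show "AE m in M. norm (G m t (u m)) \<le> B t * norm (u m)"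
        using bound_at[OF t] by eventually_elim simp
    qed (use u integrable_orbit[OF u t] in \<open>simp_all add: bochner_integrable_def\<close>)
    then show ?thesis
      using u t by (simp add: L1_pointwise_class vnorm_L1_class integrable_orbit)
  qed
  show ?thesis
    unfolding bounded_operator_def
  proof (intro conjI)
    show "\<exists>K. \<forall>U\<in>carr (L1_space sc M).
        vnorm (L1_space sc M) (lifted t U) \<le> K * vnorm (L1_space sc M) U"
      using bound by (intro exI[of _ "B t"]) (auto simp: carr_L1_space)
  qed (use carr add scale in \<open>auto simp: carr_L1_space\<close>)
qed

text \<open>Dominated convergence: the integrand tends to 0 for almost every \<open>m\<close>, and
  for times in \<open>(0, 1)\<close> it is at most \<open>(K + 1) * norm (u m)\<close>.\<close>

lemma vtendsto_lifted_zero: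
  assumes u: "bochner_integrable M u"
  shows "vtendsto (L1_space sc M) (\<lambda>t. lifted t (L1_class M u)) (L1_class M u) (at_right 0)"
proof -
  have "((\<lambda>t. \<integral>m. norm (G m t (u m) - u m) \<partial>M) \<longlongrightarrow> 0) (at_right 0)"
  proof (rule integral_tendsto_zero_at_right)
    show "(\<lambda>m. norm (G m t (u m) - u m)) \<in> borel_measurable M" if "0 < t" for t
      using bochner_integrable_diff[OF integrable_orbit[OF u] u] that
      by (intro borel_measurable_norm_bochner) (simp add: bochner_integrable_def)
    show "integrable M (\<lambda>m. (K + 1) * norm (u m))"
      using u by (simp add: bochner_integrable_def)
    show "AE m in M. norm (norm (G m t (u m) - u m)) \<le> (K + 1) * norm (u m)" if "0 < t" "t < 1" for t
      using uniform_bound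
    proof eventually_elim
      case (elim m)
      then have "norm (G m t (u m)) \<le> K * norm (u m)"
        using that by simp
      then show ?case
        using norm_triangle_ineq4[of "G m t (u m)" "u m"] by (simp add: algebra_simps)
    qed
    show "AE m in M. ((\<lambda>t. norm (G m t (u m) - u m)) \<longlongrightarrow> 0) (at_right 0)"
      using AE_bounded by eventually_elim
        (intro tendsto_norm_zero LIM_zero C0_semigroup_bounded.tendsto_zero)
  qed
  moreover have "\<forall>\<^sub>F t in at_right 0. bochner_integrable M (\<lambda>m. G m t (u m)) \<and>
      lifted t (L1_class M u) = L1_class M (\<lambda>m. G m t (u m))"
    using eventually_at_right_less[of 0] by eventually_elim (simp add: integrable_orbit u L1_pointwise_class)
  ultimately show ?thesis
    by (simp only: vtendsto_L1_class[OF sc u])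
qed

lemma C0_semigroup_lifted: "C0_semigroup (L1_space sc M) lifted"
  unfolding C0_semigroup_def
proof (intro conjI allI impI ballI)
  fix U assume "U \<in> carr (L1_space sc M)"
  then obtain u where u: "bochner_integrable M u" and U: "U = L1_class M u"
    by (auto simp: carr_L1_space)
  show "lifted 0 U = U"
    unfolding U L1_pointwise_class[OF u]
    by (rule L1_class_cong) (use AE_bounded in eventually_elim, simp add: C0_semigroup_bounded.zero)
  show "lifted (s + t) U = lifted s (lifted t U)" if "0 \<le> s" "0 \<le> t" for s t
  proof -
    have "AE m in M. G m (s + t) (u m) = G m s (G m t (u m))"
      using AE_bounded by eventually_elim (rule C0_semigroup_bounded.add[OF _ that])
    from L1_class_cong[OF this] show ?thesis
      using u that by (simp add: U L1_pointwise_class integrable_orbit)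
  qed
  show "vtendsto (L1_space sc M) (\<lambda>t. lifted t U) U (at_right 0)"
    unfolding U using u by (rule vtendsto_lifted_zero)
qed (fact bounded_operator_lifted)

text \<open>The core of the generator computation. From left to right, a subsequence converges
  almost everywhere, and at each such \<open>m\<close> the semigroup law upgrades this to the full
  limit. From right to left, the pointwise limit \<open>y m\<close> itself bounds the quotients, so
  dominated convergence applies.\<close>

lemma vtendsto_diff_quotient_lifted:
  assumes u: "bochner_integrable M u" and y: "bochner_integrable M y"
  shows "vtendsto (L1_space sc M) (diff_quotient (L1_space sc M) lifted (L1_class M u))
      (L1_class M y) (at_right 0) \<longleftrightarrow>
    (AE m in M. ((\<lambda>h. (1 / h) *\<^sub>R (G m h (u m) - u m)) \<longlongrightarrow> y m) (at_right 0))"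
    (is "?L1 \<longleftrightarrow> ?AE")
proof -
  define q where "q h m = (1 / h) *\<^sub>R (G m h (u m) - u m)" for h m
  have q: "bochner_integrable M (q h)" if "0 \<le> h" for h
    unfolding q_def
    by (intro bochner_integrable_bounded_linear[OF bounded_linear_scaleR_right]
        bochner_integrable_diff integrable_orbit u that)
  have "\<forall>\<^sub>F h in at_right 0. bochner_integrable M (q h) \<and>
      diff_quotient (L1_space sc M) lifted (L1_class M u) h = L1_class M (q h)"
    using eventually_at_right_less[of 0]
  proof eventually_elim
    case (elim h)
    then have "bochner_integrable M (\<lambda>m. G m h (u m) - u m)"
      by (intro bochner_integrable_diff integrable_orbit u) simp
    then show ?case
      using elim u q[of h]
      by (simp add: diff_quotient_def L1_pointwise_class vdiff_L1_class[OF sc] integrable_orbit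
          vscale_L1_class normed_scaling_of_real[OF sc] q_def[abs_def] del: of_real_divide)
  qed
  then have L1_iff: "?L1 \<longleftrightarrow> ((\<lambda>h. \<integral>m. norm (q h m - y m) \<partial>M) \<longlongrightarrow> 0) (at_right 0)"
    by (rule vtendsto_L1_class[OF sc y])
  \<comment> \<open>An arbitrary choice of a positive null sequence, used in both
    directions.\<close>
  define X :: "nat \<Rightarrow> real" where "X n = inverse (real (Suc n))" for n
  have X: "X \<longlonglongrightarrow> 0" "\<And>n. 0 < X n"
    unfolding X_def by (rule LIMSEQ_inverse_real_of_nat, simp)
  then have X_right: "filterlim X (at_right 0) sequentially"
    by (intro tendsto_imp_filterlim_at_right) auto
  show ?thesis
  proof
    assume ?L1
    then have "(\<lambda>n. \<integral>m. norm (q (X n) m - y m) \<partial>M) \<longlonglongrightarrow> 0"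
      using L1_iff X_right by (auto intro: filterlim_compose)
    then have lim: "(\<lambda>n. \<integral>m. norm (norm (q (X n) m - y m)) \<partial>M) \<longlonglongrightarrow> 0"
      by simp
    have "integrable M (\<lambda>m. norm (q (X n) m - y m))" for n
      using bochner_integrable_diff[OF q y] X(2)[of n] by (simp add: bochner_integrable_def less_imp_le)
    \<comment> \<open>The subsequence \<open>r\<close> is chosen once for all \<open>m\<close>;
      outside one null set every fibre converges along it.\<close>
    from tendsto_L1_AE_subseq[OF this lim]
    obtain r where r: "strict_mono r" and "AE m in M. (\<lambda>n. norm (q (X (r n)) m - y m)) \<longlonglongrightarrow> 0"
      by blast
    from AE_bounded this(2) show ?AE
    proof eventually_elim
      case (elim m)
      have "(\<lambda>n. q (X (r n)) m) \<longlonglongrightarrow> y m"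
        using elim(2) by (rule LIM_zero_cancel[OF tendsto_norm_zero_cancel])
      then show ?case
        using elim X LIMSEQ_subseq_LIMSEQ[OF X(1) r]
        by (intro C0_semigroup_bounded.tendsto_diff_quotient[of "G m" K "\<lambda>n. X (r n)"])
          (auto simp: q_def comp_def)
    qed
  next
    assume AE: ?AE
    have "((\<lambda>h. \<integral>m. norm (q h m - y m) \<partial>M) \<longlongrightarrow> 0) (at_right 0)"
    proof (rule integral_tendsto_zero_at_right)
      show "(\<lambda>m. norm (q h m - y m)) \<in> borel_measurable M" if "0 < h" for h
        using bochner_integrable_diff[OF q y] that
        by (intro borel_measurable_norm_bochner) (simp add: bochner_integrable_def)
      show "integrable M (\<lambda>m. (K + 1) * norm (y m))"
        using y by (simp add: bochner_integrable_def)
      show "AE m in M. norm (norm (q h m - y m)) \<le> (K + 1) * norm (y m)" if "0 < h" "h < 1" for h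
        using AE_bounded AE
      proof eventually_elim
        case (elim m)
        have "(\<lambda>n. (1 / X n) *\<^sub>R (G m (X n) (u m) - u m)) \<longlonglongrightarrow> y m"
          using elim(2) X_right by (rule filterlim_compose)
        from C0_semigroup_bounded.norm_diff_quotient_le[OF elim(1) X this that]
        have "norm (q h m) \<le> K * norm (y m)"
          by (simp add: q_def)
        then show ?case
          using norm_triangle_ineq4[of "q h m" "y m"] by (simp add: algebra_simps)
      qed
      show "AE m in M. ((\<lambda>h. norm (q h m - y m)) \<longlongrightarrow> 0) (at_right 0)"
        using AE by eventually_elim (auto simp: q_def intro!: tendsto_norm_zero LIM_zero)
    qed
    then show ?L1
      using L1_iff by simp
  qed
qed

text \<open>By the equivalence above, the generator of the lifted semigroup acts fibrewise. Both
  inclusions of the domains and the formula for the operator are then read off for almost every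
  \<open>m\<close>.\<close>

lemma generates_lifted:
  assumes gen: "AE m in M. generates (type_space sc) (D m) (T m) (G m)"
  shows "generates (L1_space sc M) (L1_domain M D T) (L1_pointwise M T) lifted"
proof -
  have D: "AE m in M. \<forall>x. x \<in> D m \<longleftrightarrow> (\<exists>y. ((\<lambda>h. (1 / h) *\<^sub>R (G m h x - x)) \<longlongrightarrow> y) (at_right 0))"
    using gen by eventually_elim (auto simp: generates_def vtendsto_type_space[OF sc]
        diff_quotient_type_space[OF sc, abs_def] carr_type_space)
  have T: "AE m in M. \<forall>x. x \<in> D m \<longrightarrow> ((\<lambda>h. (1 / h) *\<^sub>R (G m h x - x)) \<longlongrightarrow> T m x) (at_right 0)"
    using gen by eventually_elim (auto simp: generates_def vtendsto_type_space[OF sc]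
        diff_quotient_type_space[OF sc, abs_def])
  have image: "L1_pointwise M T (L1_class M u) \<in> carr (L1_space sc M) \<and>
      vtendsto (L1_space sc M) (diff_quotient (L1_space sc M) lifted (L1_class M u))
        (L1_pointwise M T (L1_class M u)) (at_right 0)"
    if u: "bochner_integrable M u" and "AE m in M. u m \<in> D m"
      and Tu: "bochner_integrable M (\<lambda>m. T m (u m))" for u
  proof -
    have "AE m in M. ((\<lambda>h. (1 / h) *\<^sub>R (G m h (u m) - u m)) \<longlongrightarrow> T m (u m)) (at_right 0)"
      using T that(2) by eventually_elim simp
    then show ?thesis
      using vtendsto_diff_quotient_lifted[OF u Tu] Tu
      by (auto simp: L1_pointwise_class[OF u] carr_L1_space)
  qed
  have domain: "L1_class M u \<in> L1_domain M D T"
    if u: "bochner_integrable M u" and y: "bochner_integrable M y"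
      and lim: "vtendsto (L1_space sc M) (diff_quotient (L1_space sc M) lifted (L1_class M u))
        (L1_class M y) (at_right 0)" for u y
  proof -
    have AE: "AE m in M. ((\<lambda>h. (1 / h) *\<^sub>R (G m h (u m) - u m)) \<longlongrightarrow> y m) (at_right 0)"
      using lim vtendsto_diff_quotient_lifted[OF u y] by simp
    then have "AE m in M. u m \<in> D m"
      using D by eventually_elim blast
    moreover have "AE m in M. y m = T m (u m)"
      using AE D T by eventually_elim (meson tendsto_unique trivial_limit_at_right_real)
    with y have "bochner_integrable M (\<lambda>m. T m (u m))"
      by (rule bochner_integrable_cong)
    ultimately show ?thesis
      using u unfolding L1_domain_def by blast
  qed
  have "L1_domain M D T = {U \<in> carr (L1_space sc M). \<exists>Y\<in>carr (L1_space sc M).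
      vtendsto (L1_space sc M) (diff_quotient (L1_space sc M) lifted U) Y (at_right 0)}"
    (is "_ = ?R")
  proof
    show "L1_domain M D T \<subseteq> ?R"
    proof
      fix U assume "U \<in> L1_domain M D T"
      then obtain u where u: "U = L1_class M u" "bochner_integrable M u" "AE m in M. u m \<in> D m"
          "bochner_integrable M (\<lambda>m. T m (u m))"
        unfolding L1_domain_def by blast
      then have "U \<in> carr (L1_space sc M)"
        unfolding carr_L1_space by blast
      with image[OF u(2-4)] show "U \<in> ?R"
        unfolding u(1) by blast
    qed
    show "?R \<subseteq> L1_domain M D T"
      using domain by (auto simp: carr_L1_space)
  qed
  moreover have "\<forall>U\<in>L1_domain M D T. L1_pointwise M T U \<in> carr (L1_space sc M) \<and>
      vtendsto (L1_space sc M) (diff_quotient (L1_space sc M) lifted U) (L1_pointwise M T U) (at_right 0)"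
    using image by (auto simp: L1_domain_def)
  ultimately show ?thesis
    using C0_semigroup_lifted unfolding generates_def by simp
qed

end

theorem proposition2p2:
  fixes M :: "'m measure"
    and sc :: "'k::real_normed_field \<Rightarrow> 'a::banach \<Rightarrow> 'a"
    and D :: "'m \<Rightarrow> 'a set"
    and T :: "'m \<Rightarrow> 'a \<Rightarrow> 'a"
    and G :: "'m \<Rightarrow> real \<Rightarrow> 'a \<Rightarrow> 'a"
    and C :: "'m \<Rightarrow> real"
    and \<omega> :: "'m \<Rightarrow> real"
    and B :: "real \<Rightarrow> real"
  assumes "complete_measure M"
    and "normed_scaling sc"
    and "AE m in M. generates (type_space sc) (D m) (T m) (G m) \<and> 1 \<le> C m \<and>
           (\<forall>t\<ge>0. onorm (G m t) \<le> C m * exp (\<omega> m * t))"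
    and "\<And>u t. bochner_integrable M u \<Longrightarrow> 0 \<le> t \<Longrightarrow> bochner_measurable M (\<lambda>m. G m t (u m))"
    and "\<And>t. 0 \<le> t \<Longrightarrow> 0 \<le> B t"
    and "\<And>t. 0 \<le> t \<Longrightarrow> (AE m in M. C m * exp (\<omega> m * t) \<le> B t)"
  shows "generates (L1_space sc M) (L1_domain M D T) (L1_pointwise M T)
           (\<lambda>t. L1_pointwise M (\<lambda>m. G m t))"
proof -
  \<comment> \<open>The factor \<open>B 0\<close> bounds \<open>C m\<close>, and
    \<open>max 1 (B 1)\<close> bounds the exponential on \<open>[0, 1]\<close>; the 1 covers
    negative \<open>\<omega> m\<close>.\<close>
  define K where "K = B 0 * max 1 (B 1)"
  have bound: "AE m in M. \<forall>t x. 0 \<le> t \<longrightarrow> norm (G m t x) \<le> C m * exp (\<omega> m * t) * norm x"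
    using assms(3)
  proof eventually_elim
    case (elim m)
    have "norm (G m t x) \<le> C m * exp (\<omega> m * t) * norm x" if t: "0 \<le> t" for t x
    proof -
      have "bounded_operator (type_space sc) (G m t)"
        using elim t by (simp add: generates_def C0_semigroup_def)
      then have "norm (G m t x) \<le> onorm (G m t) * norm x"
        by (intro onorm bounded_operator_type_space[OF assms(2)])
      also have "\<dots> \<le> C m * exp (\<omega> m * t) * norm x"
        using elim t by (intro mult_right_mono) auto
      finally show ?thesis .
    qed
    then show ?case by blast
  qed
  have "semigroup_family M sc G K B"
  proof (intro semigroup_family.intro semigroup_family_axioms.intro)
    show "AE m in M. C0_semigroup (type_space sc) (G m)"
      using assms(3) by eventually_elim (simp add: generates_def)
    show "0 \<le> K"
      using assms(5)[of 0] by (simp add: K_def)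
    show "AE m in M. \<forall>x. norm (G m t x) \<le> B t * norm x" if "0 \<le> t" for t
      using bound assms(6)[OF that]
      by eventually_elim (use that in \<open>meson mult_right_mono norm_ge_zero order_trans\<close>)
    \<comment> \<open>The null set in the hypothesis on \<open>B\<close> may vary with
      \<open>t\<close>. Using it only at the times 0 and 1 leaves two null sets, and monotonicity of
      the exponential controls all times in between.\<close>
    have "AE m in M. C m * exp (\<omega> m * 0) \<le> B 0" "AE m in M. C m * exp (\<omega> m * 1) \<le> B 1"
      by (auto intro!: assms(6)[of 0, simplified] assms(6)[of 1, simplified])
    with assms(3) bound
    show "AE m in M. \<forall>t x. 0 \<le> t \<longrightarrow> t \<le> 1 \<longrightarrow> norm (G m t x) \<le> K * norm x"
    proof eventually_elim
      case (elim m)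
      have "exp (\<omega> m) \<le> C m * exp (\<omega> m)"
        using elim(1) by simp
      also have "\<dots> \<le> B 1"
        using elim(4) by simp
      finally have B1: "exp (\<omega> m) \<le> B 1" .
      have "norm (G m t x) \<le> K * norm x" if t: "0 \<le> t" "t \<le> 1" for t x
      proof -
        have "exp (\<omega> m * t) \<le> max 1 (exp (\<omega> m))"
          using t mult_left_le[of t "\<omega> m"] mult_nonpos_nonneg[of "\<omega> m" t]
          by (cases "0 \<le> \<omega> m") (auto simp: le_max_iff_disj)
        also have "\<dots> \<le> max 1 (B 1)"
          using B1 by auto
        finally have "C m * exp (\<omega> m * t) \<le> K"
          unfolding K_def using elim by (intro mult_mono) auto
        then have "C m * exp (\<omega> m * t) * norm x \<le> K * norm x"
          by (rule mult_right_mono) simp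
        then show ?thesis
          using elim(2) t order_trans by blast
      qed
      then show ?case by blast
    qed
  qed (fact assms(1,2,4))+
  then show ?thesis
    by (rule semigroup_family.generates_lifted) (use assms(3) in eventually_elim, simp)
qed

end
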